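(* Let $X$, $f$, $D$, $\mu>0$ and $h$ satisfy the majorization-minimization assumption described in the context, with envelope $F$ and iteration map $p$. Suppose that for every closed ball $B\subset X$ the restriction $F|_B$ (a function on the metric space $B$) has the Kurdyka-{\L}ojasiewicz property for minimization with a concave desingularizer. Then any bounded MM sequence with initial value $f(x_0)$ near $\inf f$ converges to a minimizer of $f$; that is, for every closed ball $B\subset X$ there exists $\varepsilon>0$ such that every MM sequence $(x_k)_{k\ge0}$ contained in $B$ with $f(x_0)<\inf f+\varepsilon$ converges to a minimizer of $f$ over $X$.
   Context: Metric notions. A metric space is proper if all its closed balls are compact. A geodesic in a metric space $\bar X$ is an isometry from a compact real interval into $\bar X$ (often identified with its image); its endpoints are the images of the interval's endpoints. $\bar X$ is a geodesic space if every pair of points are the endpoints of a geodesic. A subset $D\subset\bar X$ is geodesically convex if it contains all geodesics whose endpoints lie in $D$; in that case a function $g\colon D\to\mathbf{R}$ is geodesically $\mu$-strongly convex ($\mu>0$) if its composition with every geodesic in $D$ is $\mu$-strongly convex (i.e. $t\mapsto g(\gamma(t))-\frac{\mu}{2}t^2$ is convex). Approximator: a locally Lipschitz function $h\colon X^2\to\mathbf{R}$ such that for each $\bar x\in X$ there is $\gamma\ge0$ such that all $x,y,z\in X$ near $\bar x$ satisfy $|h(x,y)-h(z,y)|\le\gamma\, d(x,z)\big(d(x,y)+d(z,y)\big)$. Majorization-minimization assumption. $X$ is a proper metric space that is a metric subspace (with inherited metric $d$) of a geodesic space $\bar X$; $f\colon X\to\mathbf{R}$ is bounded below; $D$ is a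 set-valued map assigning to each $x\in X$ a closed and geodesically convex (in $\bar X$) subset $D(x)\subset X$ containing $x$; $\mu>0$ is a constant and $h\colon X^2\to\mathbf{R}$ is a function such that for each $x\in X$ the function $h_x:=h(x,\cdot)|_{D(x)}$ is geodesically $\mu$-strongly convex on $D(x)$ and satisfies $h_x(y)\ge f(y)$ for $y\in D(x)$, with equality if $y=x$; and both $h$ and $(x,y)\mapsto\mathrm{dist}_{D(x)}(y)=\inf_{w\in D(x)}d(y,w)$ are approximators on $X$. Envelope and iteration: $F(x)=\inf_{D(x)}h_x$ and $p(x)=\mathrm{argmin}_{D(x)}h_x$. An MM sequence is a sequence with $x_{k+1}\in p(x_k)$ for all $k$. Slope: for a function $g$ on a metric space $(Y,d)$ and a point $x$ with $g(x)$ finite, $|\nabla g|(x)$ is the infimum of those $\epsilon>0$ for which $x$ is a local minimizer (in $Y$) of $y\mapsto g(y)+\epsilon\,d(x,y)$. A desingularizer is a continuous $\phi\colon[0,\infty)\to[0,\infty)$ with $\phi(0)=0$ and continuous, strictly positive derivative on $(0,\infty)$. A lower semicontinuous, bounded below function $G\colon Y\to\mathbf{R}$ on a metric space $Y$ has the KL property for minimization, with desingularizer $\phi$, if there is $\rho>0$ such that $|\nabla(\phi\circ(G-\inf_Y G))|(x)\ge1$ for all $x\in Y$ with $0<G(x)-\inf_Y G<\rho$. *)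

theory Defs
  imports "HOL-Analysis.Analysis"
begin

text \<open>
  The ambient geodesic space is a type \<open>'a\<close> of class \<open>metric_space\<close>; the metric space on which the
  functions live is a subset \<open>X\<close> of it with the inherited metric. Functions on \<open>X\<close> are total functions
  on \<open>'a\<close> whose values outside \<open>X\<close> are never used.
\<close>

definition closed_balls :: "'a::metric_space set \<Rightarrow> 'a set set" where
  "closed_balls X = {X \<inter> cball c r | c r. c \<in> X \<and> 0 \<le> r}"

definition proper_space :: "'a::metric_space set \<Rightarrow> bool" where
  "proper_space X \<longleftrightarrow> (\<forall>B\<in>closed_balls X. compact B)"


section \<open>Geodesics\<close>

definition geodesic :: "real \<Rightarrow> real \<Rightarrow> (real \<Rightarrow> 'a::metric_space) \<Rightarrow> bool" where
  "geodesic a b \<gamma> \<longleftrightarrow> a \<le> b \<and> (\<forall>s\<in>{a..b}. \<forall>t\<in>{a..b}. dist (\<gamma> s) (\<gamma> t) = dist s t)"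

definition geodesic_space :: "'a::metric_space set \<Rightarrow> bool" where
  "geodesic_space S \<longleftrightarrow>
     (\<forall>x\<in>S. \<forall>y\<in>S. \<exists>a b \<gamma>. geodesic a b \<gamma> \<and> \<gamma> ` {a..b} \<subseteq> S \<and> \<gamma> a = x \<and> \<gamma> b = y)"

text \<open>Convexity refers to all geodesics of the ambient space, not only to those inside \<open>X\<close>.\<close>

definition geodesically_convex :: "'a::metric_space set \<Rightarrow> bool" where
  "geodesically_convex S \<longleftrightarrow>
     (\<forall>a b \<gamma>. geodesic a b \<gamma> \<and> \<gamma> a \<in> S \<and> \<gamma> b \<in> S \<longrightarrow> \<gamma> ` {a..b} \<subseteq> S)"

definition geodesically_strongly_convex_on ::
    "real \<Rightarrow> 'a::metric_space set \<Rightarrow> ('a \<Rightarrow> real) \<Rightarrow> bool" where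
  "geodesically_strongly_convex_on \<mu> S g \<longleftrightarrow>
     (\<forall>a b \<gamma>. geodesic a b \<gamma> \<and> \<gamma> ` {a..b} \<subseteq> S \<longrightarrow>
        convex_on {a..b} (\<lambda>t. g (\<gamma> t) - \<mu> / 2 * t\<^sup>2))"


section \<open>Approximators and majorization-minimization\<close>

definition locally_lipschitz_on ::
    "'a::metric_space set \<Rightarrow> ('a \<Rightarrow> 'b::metric_space) \<Rightarrow> bool" where
  "locally_lipschitz_on S g \<longleftrightarrow> (\<forall>z\<in>S. \<exists>\<delta>>0. \<exists>L. L-lipschitz_on (S \<inter> ball z \<delta>) g)"

definition approximator_on :: "'a::metric_space set \<Rightarrow> ('a \<Rightarrow> 'a \<Rightarrow> real) \<Rightarrow> bool" where
  "approximator_on X h \<longleftrightarrow>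
     locally_lipschitz_on (X \<times> X) (\<lambda>(x, y). h x y) \<and>
     (\<forall>x0\<in>X. \<exists>\<gamma>\<ge>0. \<exists>\<delta>>0.
        \<forall>x\<in>X \<inter> ball x0 \<delta>. \<forall>y\<in>X \<inter> ball x0 \<delta>. \<forall>z\<in>X \<inter> ball x0 \<delta>.
          \<bar>h x y - h z y\<bar> \<le> \<gamma> * dist x z * (dist x y + dist z y))"

locale majorization_minimization =
  fixes X :: "'a::metric_space set"
    and f :: "'a \<Rightarrow> real"
    and D :: "'a \<Rightarrow> 'a set"
    and \<mu> :: real
    and h :: "'a \<Rightarrow> 'a \<Rightarrow> real"
  assumes ambient_geodesic: "geodesic_space (UNIV :: 'a set)"
    and proper: "proper_space X"
    and f_bdd_below: "bdd_below (f ` X)"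
    and D_subset: "x \<in> X \<Longrightarrow> D x \<subseteq> X"
    and D_closed: "x \<in> X \<Longrightarrow> closedin (top_of_set X) (D x)"
    and D_convex: "x \<in> X \<Longrightarrow> geodesically_convex (D x)"
    and D_self: "x \<in> X \<Longrightarrow> x \<in> D x"
    and mu_pos: "\<mu> > 0"
    and h_strongly_convex: "x \<in> X \<Longrightarrow> geodesically_strongly_convex_on \<mu> (D x) (h x)"
    and h_majorizes: "x \<in> X \<Longrightarrow> y \<in> D x \<Longrightarrow> f y \<le> h x y"
    and h_diagonal: "x \<in> X \<Longrightarrow> h x x = f x"
    and h_approximator: "approximator_on X h"
    and infdist_approximator: "approximator_on X (\<lambda>x y. infdist y (D x))"

definition mm_envelope :: "('a \<Rightarrow> 'a set) \<Rightarrow> ('a \<Rightarrow> 'a \<Rightarrow> real) \<Rightarrow> 'a \<Rightarrow> real" where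
  "mm_envelope D h x = (INF y\<in>D x. h x y)"

definition mm_iteration :: "('a \<Rightarrow> 'a set) \<Rightarrow> ('a \<Rightarrow> 'a \<Rightarrow> real) \<Rightarrow> 'a \<Rightarrow> 'a set" where
  "mm_iteration D h x = {y. is_arg_min (h x) (\<lambda>w. w \<in> D x) y}"

definition mm_sequence ::
    "'a set \<Rightarrow> ('a \<Rightarrow> 'a set) \<Rightarrow> ('a \<Rightarrow> 'a \<Rightarrow> real) \<Rightarrow> (nat \<Rightarrow> 'a) \<Rightarrow> bool" where
  "mm_sequence X D h x \<longleftrightarrow> (\<forall>k. x k \<in> X) \<and> (\<forall>k. x (Suc k) \<in> mm_iteration D h (x k))"


section \<open>Slope and the Kurdyka-Lojasiewicz property\<close>

definition local_minimizer_on :: "'a::metric_space set \<Rightarrow> ('a \<Rightarrow> real) \<Rightarrow> 'a \<Rightarrow> bool" where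
  "local_minimizer_on Y u x \<longleftrightarrow> x \<in> Y \<and> (\<forall>\<^sub>F y in at x within Y. u x \<le> u y)"

text \<open>Extended-real valued, so that the slope is \<open>\<infinity>\<close> when no \<open>\<epsilon>\<close> qualifies.\<close>

definition slope_on :: "'a::metric_space set \<Rightarrow> ('a \<Rightarrow> real) \<Rightarrow> 'a \<Rightarrow> ereal" where
  "slope_on Y g x =
     Inf {ereal \<epsilon> | \<epsilon>. 0 < \<epsilon> \<and> local_minimizer_on Y (\<lambda>y. g y + \<epsilon> * dist x y) x}"

definition desingularizer :: "(real \<Rightarrow> real) \<Rightarrow> bool" where
  "desingularizer \<phi> \<longleftrightarrow>
     continuous_on {0..} \<phi> \<and> (\<forall>t\<ge>0. 0 \<le> \<phi> t) \<and> \<phi> 0 = 0 \<and>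
     (\<exists>\<phi>'. continuous_on {0<..} \<phi>' \<and>
           (\<forall>t>0. (\<phi> has_real_derivative \<phi>' t) (at t) \<and> 0 < \<phi>' t))"

definition lower_semicontinuous_on :: "'a::metric_space set \<Rightarrow> ('a \<Rightarrow> real) \<Rightarrow> bool" where
  "lower_semicontinuous_on Y G \<longleftrightarrow> (\<forall>x\<in>Y. \<forall>c<G x. \<forall>\<^sub>F y in at x within Y. c < G y)"

definition KL_for_minimization ::
    "'a::metric_space set \<Rightarrow> ('a \<Rightarrow> real) \<Rightarrow> (real \<Rightarrow> real) \<Rightarrow> bool" where
  "KL_for_minimization Y G \<phi> \<longleftrightarrow>
     lower_semicontinuous_on Y G \<and> bdd_below (G ` Y) \<and> desingularizer \<phi> \<and>
     (\<exists>\<rho>>0. \<forall>x\<in>Y. 0 < G x - Inf (G ` Y) \<and> G x - Inf (G ` Y) < \<rho> \<longrightarrow>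
        1 \<le> slope_on Y (\<lambda>y. \<phi> (G y - Inf (G ` Y))) x)"

end

(* Strong convexity gives quadratic growth of h_x around p(x), so an MM sequence satisfies
   mu/4 d(x_{k+1}, x_{k+2})^2 <= F(x_k) - F(x_{k+1}). The approximator property lets near-minimizers
   of h_y over D(y), for y near x, be moved to D(x) at a cost proportional to d(x,y) times their
   distance from x and y; hence the slope of F at x is at most a multiple of d(x, p(x)). The multiple
   is uniform on the compact ball as long as f(x) is close to inf f, since then all the points
   involved stay in a ball of uniform radius. Combined with the KL property and concavity of the
   desingularizer phi, this gives d_{k+1} <= (d_k + C (phi(a_k) - phi(a_{k+1})))/2, where
   d_k = d(x_k, x_{k+1}) and a_k = F(x_k) - inf f, so the step lengths are summable; the slope bound
   forces a_k to tend to 0. If inf_B F > inf f, the claim is vacuous for small epsilon. *)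
theory Submission
  imports Defs
begin

section \<open>Uniform constants for approximators on compact sets\<close>

text \<open>Both requirements on an approximator, gathered on a single set with a common constant so
  that compactness can make them uniform. The Lipschitz estimate uses the sum of the two coordinate
  distances instead of the product metric.\<close>

definition approximator_bounds :: "('a::metric_space \<Rightarrow> 'a \<Rightarrow> real) \<Rightarrow> 'a set \<Rightarrow> real \<Rightarrow> bool" where
  "approximator_bounds h S c \<longleftrightarrow>
     (\<forall>u\<in>S. \<forall>v\<in>S. \<forall>w\<in>S. \<forall>z\<in>S. \<bar>h u v - h w z\<bar> \<le> c * (dist u w + dist v z)) \<and>
     (\<forall>u\<in>S. \<forall>v\<in>S. \<forall>w\<in>S. \<bar>h u v - h w v\<bar> \<le> c * (dist u w * (dist u v + dist w v)))"

lemma approximator_bounds_mono: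
  assumes "approximator_bounds h S c" "T \<subseteq> S" "c \<le> c'"
  shows "approximator_bounds h T c'"
  unfolding approximator_bounds_def
proof (intro conjI ballI)
  fix u v w z assume *: "u \<in> T" "v \<in> T" "w \<in> T" "z \<in> T"
  have "\<bar>h u v - h w z\<bar> \<le> c * (dist u w + dist v z)"
    using assms * unfolding approximator_bounds_def by blast
  also have "\<dots> \<le> c' * (dist u w + dist v z)"
    using assms by (intro mult_right_mono) auto
  finally show "\<bar>h u v - h w z\<bar> \<le> c' * (dist u w + dist v z)" .
next
  fix u v w assume *: "u \<in> T" "v \<in> T" "w \<in> T"
  have "\<bar>h u v - h w v\<bar> \<le> c * (dist u w * (dist u v + dist w v))"
    using assms * unfolding approximator_bounds_def by blast
  also have "\<dots> \<le> c' * (dist u w * (dist u v + dist w v))"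
    using assms by (intro mult_right_mono) auto
  finally show "\<bar>h u v - h w v\<bar> \<le> c' * (dist u w * (dist u v + dist w v))" .
qed

lemma approximator_on_imp_local_bounds:
  assumes "approximator_on X h" "x \<in> X"
  shows "\<exists>\<delta>>0. \<exists>c. approximator_bounds h (X \<inter> ball x \<delta>) c"
proof -
  from assms obtain \<gamma> \<delta>1 where g: "\<delta>1 > 0" "\<gamma> \<ge> 0"
    "\<And>u v w. u \<in> X \<inter> ball x \<delta>1 \<Longrightarrow> v \<in> X \<inter> ball x \<delta>1 \<Longrightarrow> w \<in> X \<inter> ball x \<delta>1 \<Longrightarrow>
      \<bar>h u v - h w v\<bar> \<le> \<gamma> * dist u w * (dist u v + dist w v)"
    unfolding approximator_on_def by meson
  from assms have "locally_lipschitz_on (X \<times> X) (\<lambda>(x, y). h x y)" "(x, x) \<in> X \<times> X"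
    unfolding approximator_on_def by auto
  then obtain \<delta>2 L where l: "\<delta>2 > 0" "L-lipschitz_on (X \<times> X \<inter> ball (x, x) \<delta>2) (\<lambda>(x, y). h x y)"
    unfolding locally_lipschitz_on_def by blast
  have L: "L \<ge> 0" using l(2) by (rule lipschitz_on_nonneg)
  \<comment> \<open>The radius \<open>\<delta>2\<close> is halved because the product distance is
    bounded by the sum of the coordinate distances.\<close>
  define \<delta> where "\<delta> = min \<delta>1 (\<delta>2 / 2)"
  have near: "(u, v) \<in> X \<times> X \<inter> ball (x, x) \<delta>2"
    if "u \<in> X \<inter> ball x \<delta>" "v \<in> X \<inter> ball x \<delta>" for u v
  proof -
    have "dist (x, x) (u, v) \<le> dist x u + dist x v"
      unfolding dist_Pair_Pair by (rule sqrt_sum_squares_le_sum) auto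
    also have "\<dots> < \<delta>2" using that unfolding \<delta>_def by auto
    finally show ?thesis using that by auto
  qed
  have lip: "\<bar>h u v - h w z\<bar> \<le> L * (dist u w + dist v z)"
    if "u \<in> X \<inter> ball x \<delta>" "v \<in> X \<inter> ball x \<delta>" "w \<in> X \<inter> ball x \<delta>" "z \<in> X \<inter> ball x \<delta>" for u v w z
  proof -
    have "\<bar>h u v - h w z\<bar> \<le> L * dist (u, v) (w, z)"
      using lipschitz_onD[OF l(2) near near, of u v w z] that by (simp add: dist_real_def)
    also have "\<dots> \<le> L * (dist u w + dist v z)"
      unfolding dist_Pair_Pair by (intro mult_left_mono sqrt_sum_squares_le_sum L) auto
    finally show ?thesis .
  qed
  have "approximator_bounds h (X \<inter> ball x \<delta>) (max L \<gamma>)"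
    unfolding approximator_bounds_def
  proof (intro conjI ballI)
    fix u v w z
    assume *: "u \<in> X \<inter> ball x \<delta>" "v \<in> X \<inter> ball x \<delta>" "w \<in> X \<inter> ball x \<delta>" "z \<in> X \<inter> ball x \<delta>"
    have "L * (dist u w + dist v z) \<le> max L \<gamma> * (dist u w + dist v z)"
      by (intro mult_right_mono) auto
    then show "\<bar>h u v - h w z\<bar> \<le> max L \<gamma> * (dist u w + dist v z)"
      using lip[OF *] by linarith
  next
    fix u v w
    assume *: "u \<in> X \<inter> ball x \<delta>" "v \<in> X \<inter> ball x \<delta>" "w \<in> X \<inter> ball x \<delta>"
    have "\<bar>h u v - h w v\<bar> \<le> \<gamma> * (dist u w * (dist u v + dist w v))"
      using g(3)[of u v w] * by (auto simp: \<delta>_def mult.assoc)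
    also have "\<dots> \<le> max L \<gamma> * (dist u w * (dist u v + dist w v))"
      by (intro mult_right_mono) auto
    finally show "\<bar>h u v - h w v\<bar> \<le> max L \<gamma> * (dist u w * (dist u v + dist w v))" .
  qed
  moreover have "\<delta> > 0" using g l by (simp add: \<delta>_def)
  ultimately show ?thesis by blast
qed

text \<open>A Lebesgue number of a cover by balls of local validity serves as the common radius:
  each ball of that radius lies in one of finitely many good balls, whose largest constant then
  works.\<close>

lemma approximator_on_imp_uniform_bounds:
  assumes "approximator_on X h" "compact B" "B \<subseteq> X"
  shows "\<exists>\<delta>>0. \<exists>c\<ge>0. \<forall>x\<in>B. approximator_bounds h (X \<inter> ball x \<delta>) c"
proof -
  have "\<forall>x\<in>B. \<exists>\<delta> c. \<delta> > 0 \<and> approximator_bounds h (X \<inter> ball x \<delta>) c"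
    using approximator_on_imp_local_bounds[OF assms(1)] assms(3) by blast
  then obtain r k where rk: "\<And>x. x \<in> B \<Longrightarrow> r x > 0"
    "\<And>x. x \<in> B \<Longrightarrow> approximator_bounds h (X \<inter> ball x (r x)) (k x)"
    by metis
  have "B \<subseteq> (\<Union>x\<in>B. ball x (r x))" using rk(1) by auto
  then obtain C where C: "C \<subseteq> B" "finite C" "B \<subseteq> (\<Union>x\<in>C. ball x (r x))"
    by (rule compactE_image[OF assms(2), rotated]) auto
  obtain \<delta> where \<delta>: "\<delta> > 0" "\<And>x. x \<in> B \<Longrightarrow> \<exists>G\<in>(\<lambda>x. ball x (r x)) ` C. ball x \<delta> \<subseteq> G"
    by (rule Heine_Borel_lemma[OF assms(2) C(3)]) auto
  \<comment> \<open>Inserting 0 makes \<open>c\<close> nonnegative and keeps the maximum defined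
    when the subcover is empty.\<close>
  define c where "c = Max (insert 0 (k ` C))"
  have "approximator_bounds h (X \<inter> ball x \<delta>) c" if xB: "x \<in> B" for x
  proof -
    obtain z where z: "z \<in> C" "ball x \<delta> \<subseteq> ball z (r z)" using \<delta>(2)[OF xB] by auto
    have "k z \<le> c" unfolding c_def using z C by (intro Max_ge) auto
    then show ?thesis
      using approximator_bounds_mono[OF rk(2)[of z], of "X \<inter> ball x \<delta>" c] z C by blast
  qed
  moreover have "c \<ge> 0" unfolding c_def using C by (intro Max_ge) auto
  ultimately show ?thesis using \<delta>(1) by blast
qed

section \<open>Moving points between the sets \<open>D x\<close>; strong convexity at
  midpoints\<close>

lemma infdist_less_obtain:
  assumes "A \<noteq> {}" "infdist x A < d"
  obtains a where "a \<in> A" "dist x a < d"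
proof -
  have "bdd_below (dist x ` A)" by (intro bdd_belowI2[of _ 0]) auto
  moreover have "(INF a\<in>A. dist x a) < d" using assms by (simp add: infdist_notempty)
  ultimately show ?thesis using assms(1) that by (auto simp: cINF_less_iff)
qed

text \<open>As \<open>v\<close> lies in \<open>D u\<close>, its distance to \<open>D u\<close>
  vanishes, so the approximator estimate directly bounds its distance to \<open>D w\<close>. The
  slack \<open>e\<close> accounts for an infimum that may only be approached.\<close>

lemma approximator_bounds_infdist_obtain:
  fixes D :: "'a::metric_space \<Rightarrow> 'a set"
  assumes "approximator_bounds (\<lambda>x y. infdist y (D x)) S c"
    and "u \<in> S" "v \<in> S" "w \<in> S" "v \<in> D u" "D w \<noteq> {}" "e > 0"
  obtains z where "z \<in> D w" "dist v z < c * (dist u w * (dist u v + dist w v)) + e"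
proof -
  have "infdist v (D w) \<le> c * (dist u w * (dist u v + dist w v))"
    using assms unfolding approximator_bounds_def
    by (smt (verit) infdist_zero)
  with \<open>e > 0\<close> have "infdist v (D w) < c * (dist u w * (dist u v + dist w v)) + e" by linarith
  from infdist_less_obtain[OF \<open>D w \<noteq> {}\<close> this] that show ?thesis by metis
qed

text \<open>Convexity of \<open>g (\<gamma> t) - \<mu> / 2 * t^2\<close> is evaluated at the
  midpoint of \<open>[a, b]\<close>; the quadratic terms leave a gain of
  \<open>\<mu> / 8 * (b - a)^2\<close>, and \<open>b - a\<close> is the distance of the
  endpoints.\<close>

lemma geodesically_strongly_convex_on_midpoint:
  assumes g: "geodesically_strongly_convex_on \<mu> S g" and S: "geodesically_convex S"
    and space: "geodesic_space (UNIV :: 'a::metric_space set)"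
    and u: "u \<in> S" and v: "v \<in> S"
  shows "\<exists>m\<in>S. g m + \<mu> / 8 * (dist u v)\<^sup>2 \<le> (g u + g (v::'a)) / 2"
proof -
  obtain a b \<gamma> where \<gamma>: "geodesic a b \<gamma>" "\<gamma> a = u" "\<gamma> b = v"
    using space[unfolded geodesic_space_def, THEN bspec, THEN bspec, OF UNIV_I UNIV_I, of u v]
    by (elim exE conjE)
  have ab: "a \<le> b" and uv: "dist u v = b - a"
    using \<gamma> unfolding geodesic_def by (auto simp: dist_real_def)
  have sub: "\<gamma> ` {a..b} \<subseteq> S"
    using S[unfolded geodesically_convex_def, rule_format, of a b \<gamma>] \<gamma> u v by simp
  let ?m = "(1/2) *\<^sub>R a + (1/2) *\<^sub>R b"
  have "convex_on {a..b} (\<lambda>t. g (\<gamma> t) - \<mu> / 2 * t\<^sup>2)"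
    using g[unfolded geodesically_strongly_convex_on_def, rule_format, of a b \<gamma>] \<gamma> sub by simp
  from convex_onD[OF this, of "1/2" a b]
  have "g (\<gamma> ?m) - \<mu> / 2 * ?m\<^sup>2 \<le> (1/2) * (g u - \<mu> / 2 * a\<^sup>2) + (1/2) * (g v - \<mu> / 2 * b\<^sup>2)"
    using ab \<gamma> by simp
  then have "g (\<gamma> ?m) + \<mu> / 8 * (dist u v)\<^sup>2 \<le> (g u + g v) / 2"
    unfolding uv by (simp add: power2_eq_square field_simps)
  moreover have "\<gamma> ?m \<in> S" using sub ab by auto
  ultimately show ?thesis by blast
qed

section \<open>Elementary properties of the envelope and the iteration map\<close>

context majorization_minimization
begin

abbreviation "F \<equiv> mm_envelope D h"

lemma Inf_f_le: "x \<in> X \<Longrightarrow> Inf (f ` X) \<le> f x"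
  by (rule cInf_lower[OF _ f_bdd_below]) simp

lemma Inf_f_le_h: "x \<in> X \<Longrightarrow> y \<in> D x \<Longrightarrow> Inf (f ` X) \<le> h x y"
  by (rule order_trans[OF Inf_f_le[OF subsetD[OF D_subset]] h_majorizes])

lemma bdd_below_h: "x \<in> X \<Longrightarrow> bdd_below (h x ` D x)"
  by (rule bdd_belowI2[OF Inf_f_le_h])

lemma envelope_le_h: "x \<in> X \<Longrightarrow> y \<in> D x \<Longrightarrow> F x \<le> h x y"
  unfolding mm_envelope_def by (rule cINF_lower[OF bdd_below_h])

lemma envelope_le_f: "x \<in> X \<Longrightarrow> F x \<le> f x"
  using envelope_le_h[of x x] D_self[of x] h_diagonal[of x] by simp

lemma Inf_f_le_envelope: "x \<in> X \<Longrightarrow> Inf (f ` X) \<le> F x"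
  unfolding mm_envelope_def using D_self[of x] by (intro cINF_greatest Inf_f_le_h) auto

lemma iteration_in_D: "p \<in> mm_iteration D h x \<Longrightarrow> p \<in> D x"
  by (simp add: mm_iteration_def is_arg_min_linorder)

lemma iteration_in_X: "x \<in> X \<Longrightarrow> p \<in> mm_iteration D h x \<Longrightarrow> p \<in> X"
  using iteration_in_D D_subset by blast

lemma envelope_eq_h:
  assumes "x \<in> X" "p \<in> mm_iteration D h x"
  shows "F x = h x p"
proof (rule antisym)
  show "F x \<le> h x p" using assms envelope_le_h iteration_in_D by blast
  show "h x p \<le> F x" unfolding mm_envelope_def
    using assms D_self by (intro cINF_greatest) (auto simp: mm_iteration_def is_arg_min_linorder)
qed

lemma envelope_near_min:
  assumes "x \<in> X" "e > 0"
  obtains y where "y \<in> D x" "h x y < F x + e"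
proof -
  have "(INF y\<in>D x. h x y) < F x + e" using assms by (simp add: mm_envelope_def)
  then show ?thesis
    using cINF_less_iff[OF _ bdd_below_h[OF assms(1)]] D_self[OF assms(1)] that by blast
qed

text \<open>\<open>F x\<close> bounds \<open>h x\<close> from below at the midpoint. Allowing
  arbitrary \<open>u\<close> and \<open>v\<close> makes the estimate applicable to near-minimizers
  as well as to minimizers.\<close>

lemma envelope_midpoint:
  assumes "x \<in> X" "u \<in> D x" "v \<in> D x"
  shows "F x + \<mu> / 8 * (dist u v)\<^sup>2 \<le> (h x u + h x v) / 2"
proof -
  obtain m where "m \<in> D x" "h x m + \<mu> / 8 * (dist u v)\<^sup>2 \<le> (h x u + h x v) / 2"
    using geodesically_strongly_convex_on_midpoint[OF h_strongly_convex[OF assms(1)]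
        D_convex[OF assms(1)] ambient_geodesic assms(2,3)] by blast
  then show ?thesis using envelope_le_h[OF assms(1), of m] by linarith
qed

text \<open>This is the midpoint inequality with \<open>v = p\<close>, where
  \<open>h x p = F x\<close>; using only the midpoint yields the factor
  \<open>\<mu> / 4\<close>.\<close>

lemma quadratic_growth:
  assumes "x \<in> X" "p \<in> mm_iteration D h x" "u \<in> D x"
  shows "\<mu> / 4 * (dist u p)\<^sup>2 \<le> h x u - F x"
  using envelope_midpoint[OF assms(1,3) iteration_in_D[OF assms(2)]] envelope_eq_h[OF assms(1,2)]
  by simp

lemma f_iteration_le_envelope:
  assumes "x \<in> X" "p \<in> mm_iteration D h x"
  shows "f p \<le> F x"
  using h_majorizes[OF assms(1) iteration_in_D[OF assms(2)]] envelope_eq_h[OF assms] by simp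

lemma uniform_bounds:
  assumes "compact B" "B \<subseteq> X"
  shows "\<exists>\<delta>>0. \<exists>c\<ge>0. \<forall>x\<in>B. approximator_bounds h (X \<inter> ball x \<delta>) c \<and>
    approximator_bounds (\<lambda>x y. infdist y (D x)) (X \<inter> ball x \<delta>) c"
proof -
  obtain \<delta>1 c1 where 1: "\<delta>1 > 0" "c1 \<ge> 0"
    "\<And>x. x \<in> B \<Longrightarrow> approximator_bounds h (X \<inter> ball x \<delta>1) c1"
    using approximator_on_imp_uniform_bounds[OF h_approximator assms] by blast
  obtain \<delta>2 c2 where 2: "\<delta>2 > 0" "c2 \<ge> 0"
    "\<And>x. x \<in> B \<Longrightarrow> approximator_bounds (\<lambda>x y. infdist y (D x)) (X \<inter> ball x \<delta>2) c2"
    using approximator_on_imp_uniform_bounds[OF infdist_approximator assms] by blast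
  have "approximator_bounds h (X \<inter> ball x (min \<delta>1 \<delta>2)) (max c1 c2) \<and>
    approximator_bounds (\<lambda>x y. infdist y (D x)) (X \<inter> ball x (min \<delta>1 \<delta>2)) (max c1 c2)"
    if "x \<in> B" for x
    by (intro conjI approximator_bounds_mono[OF 1(3)[OF that]] approximator_bounds_mono[OF 2(3)[OF that]])
      auto
  then show ?thesis using 1 2
    by (intro exI[of _ "min \<delta>1 \<delta>2"] conjI exI[of _ "max c1 c2"]) auto
qed

text \<open>\<open>f\<close> is the diagonal of \<open>h\<close>, so it inherits continuity from the
  local Lipschitz bound on \<open>h\<close>.\<close>

lemma f_tendsto:
  assumes "x \<in> X"
  shows "(f \<longlongrightarrow> f x) (at x within X)"
proof -
  obtain \<delta> c where *: "\<delta> > 0" "approximator_bounds h (X \<inter> ball x \<delta>) c"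
    using approximator_on_imp_local_bounds[OF h_approximator assms] by blast
  have "\<forall>\<^sub>F y in at x within X. norm (f y - f x) \<le> c * (dist y x + dist y x)"
    unfolding eventually_at
  proof (intro exI conjI ballI impI)
    fix y assume "y \<in> X" "y \<noteq> x \<and> dist y x < \<delta>"
    then have "y \<in> X \<inter> ball x \<delta>" "x \<in> X \<inter> ball x \<delta>"
      using * assms by (auto simp: dist_commute)
    then have "\<bar>h y y - h x x\<bar> \<le> c * (dist y x + dist y x)"
      using *(2) unfolding approximator_bounds_def by blast
    then show "norm (f y - f x) \<le> c * (dist y x + dist y x)"
      using h_diagonal \<open>y \<in> X\<close> assms by simp
  qed (use * in auto)
  moreover have "((\<lambda>y. c * (dist y x + dist y x)) \<longlongrightarrow> 0) (at x within X)"
    by (auto intro!: tendsto_eq_intros)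
  ultimately show ?thesis
    by (subst Lim_null) (rule Lim_null_comparison)
qed

section \<open>Slope of the envelope\<close>

text \<open>A near-minimizer \<open>w\<close> of \<open>h y\<close> is moved to a point
  \<open>w'\<close> of \<open>D x\<close>, and \<open>F x \<le> h x w'\<close> is compared with
  \<open>h y w\<close>. The cost is of order \<open>dist x y\<close> times
  \<open>dist y w + dist x w\<close>, and the second factor is at most \<open>2 * dist x p\<close>
  plus \<open>\<sigma> (dist x y)\<close>, where \<open>\<sigma>\<close> is an explicit modulus
  vanishing at 0.\<close>

lemma envelope_descent:
  fixes \<sigma> :: "real \<Rightarrow> real"
  assumes x: "x \<in> X" and p: "p \<in> mm_iteration D h x" and c: "c \<ge> 0"
    and bounds: "approximator_bounds h (X \<inter> ball x \<delta>) c"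
      "approximator_bounds (\<lambda>x y. infdist y (D x)) (X \<inter> ball x \<delta>) c"
    and px: "dist x p < \<delta> / 4"
    and y: "y \<in> X" "y \<noteq> x" "dist x y < \<delta> / 4"
    and fy: "f y - Inf (f ` X) + (dist x y)\<^sup>2 < \<mu> * \<delta>\<^sup>2 / 64"
    and small: "c * dist x y * \<delta> + (dist x y)\<^sup>2 < \<delta> / 4"
    and \<sigma>: "\<And>s. \<sigma> s = s + 2 * (c * s * \<delta> + s\<^sup>2)
               + 2 * sqrt (4 / \<mu> * (s\<^sup>2 + c * (2 * s + 2 * (c * s * \<delta> + s\<^sup>2))))"
  shows "F x - ((c + c\<^sup>2) * (2 * dist x p + \<sigma> (dist x y)) + (1 + c) * dist x y) * dist x y \<le> F y"
proof -
  define s where "s = dist x y"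
  define r where "r = dist x p"
  have s: "s > 0" using y by (simp add: s_def)
  then have \<delta>: "\<delta> > 0" using y(3) unfolding s_def by linarith
  let ?S = "X \<inter> ball x \<delta>"
  \<comment> \<open>A crude common bound for the corrections \<open>dist w w'\<close> and
    \<open>dist p p'\<close>, obtained by estimating the relevant sums of distances by
    \<open>\<delta>\<close>.\<close>
  let ?\<eta> = "c * s * \<delta> + s\<^sup>2"
  have s4: "s < \<delta> / 4" and r4: "r < \<delta> / 4" using y px by (auto simp: s_def r_def)
  have xS: "x \<in> ?S" and yS: "y \<in> ?S" and pS: "p \<in> ?S"
    using x y \<delta> px iteration_in_X[OF x p] by auto
  have lip: "\<bar>h u v - h w z\<bar> \<le> c * (dist u w + dist v z)"
    if "u \<in> ?S" "v \<in> ?S" "w \<in> ?S" "z \<in> ?S" for u v w z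
    using bounds(1) that unfolding approximator_bounds_def by blast
  have app: "\<bar>h u v - h w v\<bar> \<le> c * (dist u w * (dist u v + dist w v))"
    if "u \<in> ?S" "v \<in> ?S" "w \<in> ?S" for u v w
    using bounds(1) that unfolding approximator_bounds_def by blast
  \<comment> \<open>Near-minimizers suffice: an error \<open>s\<^sup>2\<close> is negligible against the linear term, so existence of
    minimizers of \<open>h y\<close> is not needed.\<close>
  obtain w where w: "w \<in> D y" "h y w < F y + s\<^sup>2"
    using envelope_near_min[OF y(1), of "s\<^sup>2"] s by auto
  \<comment> \<open>Applied to the pair \<open>y\<close>, \<open>w\<close>, the midpoint inequality
    confines \<open>w\<close> to the ball of radius \<open>\<delta> / 4\<close> around
    \<open>y\<close>; the threshold \<open>\<mu> * \<delta>^2 / 64\<close> is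
    \<open>\<mu> / 4 * (\<delta> / 4)^2\<close>.\<close>
  have "\<mu> / 4 * (dist y w)\<^sup>2 \<le> f y - F y + s\<^sup>2"
    using envelope_midpoint[OF y(1) D_self[OF y(1)] w(1)] w(2) h_diagonal[OF y(1)] by simp
  also have "\<dots> < \<mu> / 4 * (\<delta> / 4)\<^sup>2"
    using Inf_f_le_envelope[OF y(1)] fy by (simp add: s_def power2_eq_square)
  finally have "(dist y w)\<^sup>2 < (\<delta> / 4)\<^sup>2" using mu_pos by simp
  then have yw: "dist y w < \<delta> / 4" by (rule power2_less_imp_less) (use \<delta> in auto)
  have xw: "dist x w \<le> s + dist y w" unfolding s_def by (rule dist_triangle)
  have wS: "w \<in> ?S" using w(1) D_subset[OF y(1)] xw yw s4 \<delta> by auto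
  define T where "T = dist y w + dist x w"
  have T: "0 \<le> T" "T \<le> \<delta>" using xw yw s4 \<delta> by (auto simp: T_def)
  obtain w' where w': "w' \<in> D x" "dist w w' < c * (s * T) + s\<^sup>2"
    using approximator_bounds_infdist_obtain[OF bounds(2) yS wS xS w(1), of "s\<^sup>2"] D_self[OF x] s
    by (metis T_def dist_commute empty_iff s_def zero_less_power)
  have "c * (s * T) \<le> c * (s * \<delta>)" using c s T by (intro mult_left_mono) auto
  then have ww': "dist w w' \<le> ?\<eta>" using w' by (simp add: mult.assoc)
  have xw': "dist x w' \<le> dist x w + dist w w'" by (rule dist_triangle)
  have w'S: "w' \<in> ?S" using w'(1) D_subset[OF x] xw xw' yw s4 ww' small \<delta> by (auto simp: s_def)
  have py: "dist y p \<le> s + r"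
    unfolding s_def r_def by (metis dist_commute dist_triangle)
  obtain p' where p': "p' \<in> D y" "dist p p' < c * (dist x y * (dist x p + dist y p)) + s\<^sup>2"
    by (rule approximator_bounds_infdist_obtain[OF bounds(2) xS pS yS iteration_in_D[OF p], of "s\<^sup>2"])
      (use D_self[OF y(1)] s in auto)
  note p' = p'[folded s_def r_def]
  have "c * (s * (r + dist y p)) \<le> c * (s * \<delta>)"
    using c s py r4 s4 by (intro mult_left_mono) auto
  then have pp': "dist p p' \<le> ?\<eta>" using p' by (simp add: mult.assoc)
  have xp': "dist x p' \<le> r + dist p p'" unfolding r_def by (rule dist_triangle)
  have p'S: "p' \<in> ?S" using p'(1) D_subset[OF y(1)] xp' r4 pp' small \<delta> by (auto simp: s_def)
  \<comment> \<open>Since \<open>p\<close> is close to \<open>D y\<close>, \<open>F y\<close> is not much larger than \<open>F x\<close>, and quadratic growth then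
    forces \<open>w\<close> to be close to \<open>p\<close>.\<close>
  have "h y p' \<le> F x + c * (s + dist p p')"
    using lip[OF xS pS yS p'S] envelope_eq_h[OF x p] by (simp add: s_def)
  then have 1: "F y \<le> F x + c * (s + dist p p')"
    using envelope_le_h[OF y(1) p'(1)] by linarith
  have "h x w' \<le> h y w + c * (s + dist w w')"
    using lip[OF xS w'S yS wS] by (simp add: s_def dist_commute)
  then have "\<mu> / 4 * (dist w' p)\<^sup>2 \<le> s\<^sup>2 + c * (s + dist w w') + c * (s + dist p p')"
    using quadratic_growth[OF x p w'(1)] w(2) 1 by linarith
  also have "\<dots> \<le> s\<^sup>2 + c * (s + ?\<eta>) + c * (s + ?\<eta>)"
    using c ww' pp' by (intro add_mono mult_left_mono) auto
  also have "\<dots> = s\<^sup>2 + c * (2 * s + 2 * ?\<eta>)" by (simp add: algebra_simps)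
  finally have "(dist w' p)\<^sup>2 \<le> 4 / \<mu> * (s\<^sup>2 + c * (2 * s + 2 * ?\<eta>))"
    using mu_pos by (simp add: field_simps)
  moreover define q where "q = sqrt (4 / \<mu> * (s\<^sup>2 + c * (2 * s + 2 * ?\<eta>)))"
  ultimately have w'p: "dist w' p \<le> q" using real_le_rsqrt by simp
  have \<sigma>s: "\<sigma> s = s + 2 * ?\<eta> + 2 * q" by (simp add: \<sigma> q_def)
  \<comment> \<open>\<open>T\<close> is at most \<open>s + 2 * dist x w\<close>, and
    \<open>dist x w\<close> is at most \<open>r + dist w p\<close>; this is the origin of the term
    \<open>2 * r\<close> and of the shape of \<open>\<sigma>\<close>.\<close>
  have "dist w p \<le> dist w w' + dist w' p" by (rule dist_triangle)
  moreover have "dist x w \<le> r + dist w p"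
    unfolding r_def by (metis dist_commute dist_triangle)
  moreover have "dist y w \<le> s + dist x w"
    unfolding s_def by (metis dist_commute dist_triangle)
  ultimately have T2: "T \<le> 2 * r + \<sigma> s"
    using ww' w'p unfolding T_def \<sigma>s by (smt (verit))
  \<comment> \<open>First the objective changes from \<open>h y\<close> to \<open>h x\<close> at the
    fixed point \<open>w\<close>, then the point changes from \<open>w\<close> to \<open>w'\<close>.
    Beyond the terms in \<open>s * T\<close>, only multiples of \<open>s^2\<close> are lost.\<close>
  have "h x w \<le> h y w + c * (s * T)"
    using app[OF yS wS xS] by (simp add: s_def T_def dist_commute)
  moreover have "h x w' \<le> h x w + c * dist w w'"
    using lip[OF xS w'S xS wS] by (simp add: dist_commute)
  moreover have "c * dist w w' \<le> c * (c * (s * T) + s\<^sup>2)" using w' c by (intro mult_left_mono) auto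
  moreover have "F x \<le> h x w'" by (rule envelope_le_h[OF x w'(1)])
  ultimately have "F x \<le> F y + s\<^sup>2 + c * (s * T) + c * (c * (s * T) + s\<^sup>2)"
    using w(2) by linarith
  also have "\<dots> = F y + (c + c\<^sup>2) * s * T + (1 + c) * s\<^sup>2"
    by (simp add: algebra_simps power2_eq_square)
  also have "\<dots> \<le> F y + (c + c\<^sup>2) * s * (2 * r + \<sigma> s) + (1 + c) * s\<^sup>2"
    using T2 c s by (intro add_mono mult_left_mono) auto
  finally show ?thesis unfolding s_def[symmetric] r_def[symmetric]
    by (simp add: algebra_simps power2_eq_square)
qed

text \<open>By continuity of \<open>f\<close>, all smallness conditions of
  \<open>envelope_descent\<close> hold for \<open>y\<close> near \<open>x\<close>, and the remainder
  coefficient drops below \<open>e\<close>. This is the bound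
  \<open>2 * (c + c^2) * dist x p\<close> on the slope of \<open>F\<close>, in a form free of
  infima.\<close>

lemma envelope_slope_bound:
  assumes x: "x \<in> X" and p: "p \<in> mm_iteration D h x" and c: "c \<ge> 0" and \<delta>: "\<delta> > 0"
    and bounds: "approximator_bounds h (X \<inter> ball x \<delta>) c"
      "approximator_bounds (\<lambda>x y. infdist y (D x)) (X \<inter> ball x \<delta>) c"
    and fx: "f x < Inf (f ` X) + \<mu> * \<delta>\<^sup>2 / 64" and e: "e > 0"
  shows "\<forall>\<^sub>F y in at x within X. F x - (2 * (c + c\<^sup>2) * dist x p + e) * dist x y \<le> F y"
proof -
  define \<sigma> where "\<sigma> = (\<lambda>s. s + 2 * (c * s * \<delta> + s\<^sup>2)
               + 2 * sqrt (4 / \<mu> * (s\<^sup>2 + c * (2 * s + 2 * (c * s * \<delta> + s\<^sup>2)))))"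
  let ?A = "at x within X"
  have lim: "((\<lambda>y. dist x y) \<longlongrightarrow> 0) ?A"
    by (auto intro!: tendsto_eq_intros)
  have "((\<lambda>y. f y - Inf (f ` X) + (dist x y)\<^sup>2) \<longlongrightarrow> f x - Inf (f ` X) + 0\<^sup>2) ?A"
    by (intro tendsto_intros lim f_tendsto x)
  then have 1: "\<forall>\<^sub>F y in ?A. f y - Inf (f ` X) + (dist x y)\<^sup>2 < \<mu> * \<delta>\<^sup>2 / 64"
    using fx by (intro order_tendstoD) auto
  have "((\<lambda>y. c * dist x y * \<delta> + (dist x y)\<^sup>2) \<longlongrightarrow> c * 0 * \<delta> + 0\<^sup>2) ?A"
    by (intro tendsto_intros lim)
  then have 2: "\<forall>\<^sub>F y in ?A. c * dist x y * \<delta> + (dist x y)\<^sup>2 < \<delta> / 4"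
    using \<delta> by (intro order_tendstoD) auto
  have 3: "\<forall>\<^sub>F y in ?A. dist x y < \<delta> / 4"
    using \<delta> by (intro order_tendstoD[OF lim]) auto
  have "((\<lambda>y. (c + c\<^sup>2) * \<sigma> (dist x y) + (1 + c) * dist x y) \<longlongrightarrow> (c + c\<^sup>2) * \<sigma> 0 + (1 + c) * 0) ?A"
    unfolding \<sigma>_def by (intro tendsto_intros lim)
  then have 4: "\<forall>\<^sub>F y in ?A. (c + c\<^sup>2) * \<sigma> (dist x y) + (1 + c) * dist x y < e"
    using e by (intro order_tendstoD) (auto simp: \<sigma>_def)
  have "\<mu> / 4 * (dist x p)\<^sup>2 \<le> f x - F x"
    using quadratic_growth[OF x p D_self[OF x]] h_diagonal[OF x] by simp
  also have "\<dots> < \<mu> / 4 * (\<delta> / 4)\<^sup>2"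
    using Inf_f_le_envelope[OF x] fx by (simp add: power2_eq_square)
  finally have "(dist x p)\<^sup>2 < (\<delta> / 4)\<^sup>2" using mu_pos by simp
  then have px: "dist x p < \<delta> / 4" by (rule power2_less_imp_less) (use \<delta> in auto)
  have 5: "\<forall>\<^sub>F y in ?A. y \<in> X \<and> y \<noteq> x" by (auto simp: eventually_at_filter)
  from 1 2 3 4 5 show ?thesis
  proof eventually_elim
    case (elim y)
    let ?t = "(c + c\<^sup>2) * \<sigma> (dist x y) + (1 + c) * dist x y"
    have "F x - (2 * (c + c\<^sup>2) * dist x p + ?t) * dist x y \<le> F y"
      using envelope_descent[OF x p c bounds px _ _ elim(3,1,2), of \<sigma>] elim(5)
      by (simp add: \<sigma>_def algebra_simps)
    moreover have "?t * dist x y \<le> e * dist x y"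
      using elim(4) by (intro mult_right_mono) auto
    ultimately show ?case by (simp add: algebra_simps)
  qed
qed

end

section \<open>Chain rule for the slope, sequences of finite length, desingularizers\<close>

text \<open>If \<open>\<phi>' * R < 1\<close>, some \<open>\<tau> > 0\<close> still gives
  \<open>(\<phi>' + \<tau>) * (R + \<tau>) < 1\<close>. With this product as penalty,
  \<open>x\<close> is a local minimizer of the penalized composition, so its slope is below 1, a
  contradiction.\<close>

lemma slope_chain_rule_bound:
  fixes G :: "'a::metric_space \<Rightarrow> real"
  assumes x: "x \<in> Y" and u: "m < G x" and low: "\<And>y. y \<in> Y \<Longrightarrow> m \<le> G y"
    and d: "(\<phi> has_real_derivative \<phi>') (at (G x - m))" and \<phi>': "\<phi>' > 0"
    and mono: "mono_on {0..} \<phi>" and R: "R \<ge> 0"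
    and slope: "1 \<le> slope_on Y (\<lambda>y. \<phi> (G y - m)) x"
    and ev: "\<And>e. e > 0 \<Longrightarrow> \<forall>\<^sub>F y in at x within Y. G x - (R + e) * dist x y \<le> G y"
  shows "1 \<le> \<phi>' * R"
proof (rule ccontr)
  assume "\<not> 1 \<le> \<phi>' * R"
  moreover have "((\<lambda>t. (\<phi>' + t) * (R + t)) \<longlongrightarrow> (\<phi>' + 0) * (R + 0)) (at_right 0)"
    by (intro tendsto_intros)
  ultimately have "\<forall>\<^sub>F t in at_right 0. (\<phi>' + t) * (R + t) < 1"
    by (intro order_tendstoD) auto
  then have "\<forall>\<^sub>F t in at_right 0. (\<phi>' + t) * (R + t) < 1 \<and> t > 0"
    by (intro eventually_conj) (auto simp: eventually_at_filter)
  then obtain \<tau> where \<tau>: "(\<phi>' + \<tau>) * (R + \<tau>) < 1" "\<tau> > 0"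
    using eventually_happens' trivial_limit_at_right_real by blast
  let ?u = "G x - m" and ?q = "(\<phi>' + \<tau>) * (R + \<tau>)" and ?A = "at x within Y"
  have q: "?q > 0" using \<tau> \<phi>' R by (intro mult_pos_pos) auto
  have "((\<lambda>t. (\<phi> (?u + t) - \<phi> ?u) / t) \<longlongrightarrow> \<phi>') (at 0)"
    using d by (simp add: DERIV_def)
  then have "\<forall>\<^sub>F t in at 0. (\<phi> (?u + t) - \<phi> ?u) / t < \<phi>' + \<tau>"
    using \<tau> by (intro order_tendstoD) auto
  then obtain k where k: "k > 0" "\<And>t. t \<noteq> 0 \<Longrightarrow> \<bar>t\<bar> < k \<Longrightarrow> (\<phi> (?u + t) - \<phi> ?u) / t < \<phi>' + \<tau>"
    unfolding eventually_at by (auto simp: dist_real_def)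
  have "((\<lambda>y. (R + \<tau>) * dist x y) \<longlongrightarrow> (R + \<tau>) * 0) ?A"
    by (intro tendsto_intros) (auto intro!: tendsto_eq_intros)
  \<comment> \<open>\<open>k\<close> keeps the difference quotient under control; \<open>?u\<close>
    keeps the argument of \<open>\<phi>\<close> positive, where monotonicity is available.\<close>
  then have 1: "\<forall>\<^sub>F y in ?A. (R + \<tau>) * dist x y < min k ?u"
    using k u by (intro order_tendstoD) auto
  have 2: "\<forall>\<^sub>F y in ?A. y \<in> Y \<and> y \<noteq> x" by (auto simp: eventually_at_filter)
  have "\<forall>\<^sub>F y in ?A. \<phi> ?u + ?q * dist x x \<le> \<phi> (G y - m) + ?q * dist x y"
    using 1 2 ev[OF \<tau>(2)]
  proof eventually_elim
    case (elim y)
    define t where "t = (R + \<tau>) * dist x y"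
    have t: "t > 0" unfolding t_def using elim \<tau> R by (intro mult_pos_pos) auto
    have "(\<phi> (?u + (- t)) - \<phi> ?u) / (- t) < \<phi>' + \<tau>"
      using t elim(1) by (intro k(2)) (auto simp: t_def)
    then have "\<phi> ?u - \<phi> (?u - t) < (\<phi>' + \<tau>) * t"
      using t by (simp add: field_simps)
    moreover have "\<phi> (?u - t) \<le> \<phi> (G y - m)"
      using elim low by (intro mono_onD[OF mono]) (auto simp: t_def)
    ultimately show ?case by (simp add: mult.assoc t_def)
  qed
  then have "slope_on Y (\<lambda>y. \<phi> (G y - m)) x \<le> ereal ?q"
    unfolding slope_on_def local_minimizer_on_def using q x by (intro Inf_lower) auto
  then have "1 \<le> ereal ?q" using slope by (rule order_trans[rotated])
  then show False using \<tau>(1) by simp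
qed

text \<open>The quantity \<open>(\<Sum>k<n. d k) + 2 * d n + b n\<close> does not increase with
  \<open>n\<close>.\<close>

lemma summable_of_contraction_telescoping:
  fixes d b :: "nat \<Rightarrow> real"
  assumes d: "\<And>k. 0 \<le> d k" and b: "\<And>k. 0 \<le> b k"
    and step: "\<And>k. d (Suc k) \<le> (d k + (b k - b (Suc k))) / 2"
  shows "summable d"
proof (rule summableI_nonneg_bounded)
  fix n
  have "(\<Sum>k<n. d k) + 2 * d n + b n \<le> 2 * d 0 + b 0"
  proof (induction n)
    case 0 show ?case using d[of 0] by simp
  next
    case (Suc n) then show ?case using step[of n] by simp
  qed
  then show "(\<Sum>k<n. d k) \<le> 2 * d 0 + b 0" using d[of n] b[of n] by linarith
qed (rule d)

lemma Cauchy_of_summable_dist: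
  fixes x :: "nat \<Rightarrow> 'a::metric_space"
  assumes "summable (\<lambda>k. dist (x k) (x (Suc k)))"
  shows "Cauchy x"
  unfolding Cauchy_altdef2
proof (intro allI impI)
  fix e :: real assume "e > 0"
  then obtain N where N: "\<And>n. norm (\<Sum>k=N..<n. dist (x k) (x (Suc k))) < e"
    using assms unfolding summable_Cauchy by blast
  have "dist (x n) (x N) < e" if "n \<ge> N" for n
  proof -
    have "dist (x N) (x n) \<le> (\<Sum>k=N..<n. dist (x k) (x (Suc k)))"
      using that
    proof (induction n rule: dec_induct)
      case (step n) then show ?case using dist_triangle[of "x N" "x (Suc n)" "x n"] by simp
    qed simp
    then show ?thesis using N[of n] by (simp add: dist_commute)
  qed
  then show "\<exists>N. \<forall>n\<ge>N. dist (x n) (x N) < e" by blast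
qed

lemma desingularizer_mono_on:
  assumes "desingularizer \<phi>"
  shows "mono_on {0..} \<phi>"
proof (rule mono_onI)
  fix a b :: real assume ab: "a \<in> {0..}" "b \<in> {0..}" "a \<le> b"
  obtain \<phi>' where *: "\<And>t. t > 0 \<Longrightarrow> (\<phi> has_real_derivative \<phi>' t) (at t) \<and> 0 < \<phi>' t"
    using assms unfolding desingularizer_def by blast
  show "\<phi> a \<le> \<phi> b"
  \<comment> \<open>The derivative is given only on the open half-line; at 0 the nonnegativity of
    \<open>\<phi>\<close> takes over.\<close>
  proof (cases "a = 0")
    case True then show ?thesis using assms ab unfolding desingularizer_def by auto
  next
    case False
    then have "\<exists>y. (\<phi> has_real_derivative y) (at t) \<and> 0 \<le> y" if "a \<le> t" for t
      using *[of t] ab that by (auto intro: less_imp_le)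
    then show ?thesis by (rule DERIV_nonneg_imp_nondecreasing[OF ab(3)])
  qed
qed

lemma concave_diff_ge_tangent:
  fixes \<phi> :: "real \<Rightarrow> real"
  assumes "concave_on {0..} \<phi>" "(\<phi> has_real_derivative \<phi>') (at a)" "a > 0" "b \<ge> 0"
  shows "\<phi>' * (a - b) \<le> \<phi> a - \<phi> b"
proof -
  have "- \<phi> b - (- \<phi> a) \<ge> (- \<phi>') * (b - a)"
    using assms by (intro convex_on_imp_above_tangent[of "{0..}"])
      (auto simp: concave_on_def interior_Ici intro!: DERIV_minus intro: has_field_derivative_at_within)
  then show ?thesis by (simp add: algebra_simps)
qed

section \<open>Convergence of MM sequences\<close>

context majorization_minimization
begin

text \<open>The KL bound and the tangent inequality give
  \<open>a - b \<le> K * d * (\<phi> a - \<phi> b)\<close>. Quadratic growth turns this into a bound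
  of \<open>e^2\<close> by a product, which the arithmetic-geometric mean inequality splits.\<close>

lemma mm_sequence_KL_step:
  assumes desing: "desingularizer \<phi>" and conc: "concave_on {0..} \<phi>"
    and ab: "0 \<le> b" "b \<le> a" and K: "K > 0" and d: "d \<ge> 0"
    and growth: "\<mu> / 4 * e\<^sup>2 \<le> a - b"
    and deriv: "a > 0 \<Longrightarrow> (\<phi> has_real_derivative \<phi>') (at a)"
    and kl: "a > 0 \<Longrightarrow> 1 \<le> \<phi>' * (K * d)"
  shows "e \<le> (d + (4 * K / \<mu> * \<phi> a - 4 * K / \<mu> * \<phi> b)) / 2"
proof -
  let ?D = "\<phi> a - \<phi> b"
  have D: "?D \<ge> 0"
    using mono_onD[OF desingularizer_mono_on[OF desing], of b a] ab by simp
  have "a - b \<le> K * d * ?D"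
  proof (cases "a > 0")
    case True
    have "a - b \<le> (\<phi>' * (K * d)) * (a - b)"
      using mult_right_mono[OF kl[OF True], of "a - b"] ab by simp
    also have "\<dots> = K * d * (\<phi>' * (a - b))" by simp
    also have "\<dots> \<le> K * d * ?D"
      using K d concave_diff_ge_tangent[OF conc deriv[OF True] True ab(1)]
      by (intro mult_left_mono) auto
    finally show ?thesis .
  next
    \<comment> \<open>Here both values are 0, so the decrease vanishes without any KL
      information.\<close>
    case False
    with ab have "a = b" by linarith
    then show ?thesis by simp
  qed
  with growth have "\<mu> / 4 * e\<^sup>2 \<le> K * d * ?D" by linarith
  then have e2: "e\<^sup>2 \<le> d * (4 * K / \<mu> * ?D)" using mu_pos by (simp add: field_simps)
  define E where "E = 4 * K / \<mu> * ?D"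
  have E: "E \<ge> 0" unfolding E_def using K mu_pos D by simp
  have "(2 * e)\<^sup>2 \<le> 4 * (d * E)" using e2 unfolding E_def by (simp add: power_mult_distrib)
  also have "4 * (u * v) \<le> (u + v)\<^sup>2" for u v :: real
    using zero_le_power2[of "u - v"] by (simp add: power2_eq_square algebra_simps)
  finally have "2 * e \<le> d + E" by (rule power2_le_imp_le) (use d E in auto)
  then have "e \<le> (d + E) / 2" by simp
  then show ?thesis unfolding E_def right_diff_distrib .
qed

lemma mm_sequence_descent:
  assumes "mm_sequence X D h x"
  shows "x k \<in> X" "x (Suc k) \<in> mm_iteration D h (x k)"
    "\<mu> / 4 * (dist (x k) (x (Suc k)))\<^sup>2 \<le> f (x k) - F (x k)"
    "f (x (Suc k)) \<le> F (x k)" "F (x (Suc k)) \<le> F (x k)"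
proof -
  have *: "x k \<in> X" "x (Suc k) \<in> mm_iteration D h (x k)" for k
    using assms by (auto simp: mm_sequence_def)
  then show "x k \<in> X" "x (Suc k) \<in> mm_iteration D h (x k)" by auto
  show "\<mu> / 4 * (dist (x k) (x (Suc k)))\<^sup>2 \<le> f (x k) - F (x k)"
    using quadratic_growth[OF *[of k] D_self[OF *(1)[of k]]] h_diagonal[OF *(1)[of k]] by simp
  show "f (x (Suc k)) \<le> F (x k)" by (rule f_iteration_le_envelope[OF *])
  then show "F (x (Suc k)) \<le> F (x k)" using envelope_le_f[OF *(1)[of "Suc k"]] by linarith
qed

lemma mm_sequence_f_le_initial:
  assumes "mm_sequence X D h x"
  shows "f (x k) \<le> f (x 0)"
proof (induction k)
  case (Suc k)
  then show ?case
    using mm_sequence_descent(1,4)[OF assms, of k] envelope_le_f[of "x k"] by linarith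
qed simp

text \<open>Summable steps give a limit in \<open>B\<close>. A positive limit \<open>l\<close> of
  the gaps would contradict \<open>kl\<close>, since \<open>\<phi>'\<close> is continuous at
  \<open>l\<close> and the steps tend to 0. Hence \<open>F (x k)\<close> tends to the infimum and,
  being at least \<open>f (x (Suc k))\<close>, forces the limit to be a minimizer.\<close>

lemma mm_sequence_tendsto_minimizer:
  assumes mm: "mm_sequence X D h x" and B: "compact B" "B \<subseteq> X" "range x \<subseteq> B"
    and desing: "desingularizer \<phi>" and conc: "concave_on {0..} \<phi>" and K: "K > 0"
    and deriv: "continuous_on {0<..} \<phi>'" "\<And>t. t > 0 \<Longrightarrow> (\<phi> has_real_derivative \<phi>' t) (at t)"
    and kl: "\<And>k. F (x k) > Inf (f ` X) \<Longrightarrow>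
               1 \<le> \<phi>' (F (x k) - Inf (f ` X)) * (K * dist (x k) (x (Suc k)))"
  shows "\<exists>x'\<in>X. x \<longlonglongrightarrow> x' \<and> (\<forall>y\<in>X. f x' \<le> f y)"
proof -
  define a where "a k = F (x k) - Inf (f ` X)" for k
  define d where "d k = dist (x k) (x (Suc k))" for k
  define b where "b k = 4 * K / \<mu> * \<phi> (a k)" for k
  note desc = mm_sequence_descent[OF mm]
  have a: "0 \<le> a k" "a (Suc k) \<le> a k" for k
    using Inf_f_le_envelope[OF desc(1)] desc(5) by (auto simp: a_def)
  have step: "d (Suc k) \<le> (d k + (b k - b (Suc k))) / 2" for k
    unfolding b_def
  proof (rule mm_sequence_KL_step[OF desing conc a K])
    show "\<mu> / 4 * (d (Suc k))\<^sup>2 \<le> a k - a (Suc k)"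
      \<comment> \<open>The index shift matters: growth at \<open>x (Suc k)\<close> involves
        \<open>f (x (Suc k))\<close>, which is at most \<open>F (x k)\<close>, so the step is
        controlled by a decrease of the envelope alone.\<close>
      using desc(3)[of "Suc k"] desc(4)[of k] by (simp add: a_def d_def)
  qed (use kl[of k] deriv in \<open>auto simp: d_def a_def\<close>)
  have "b k \<ge> 0" for k
    using desing a K mu_pos unfolding b_def desingularizer_def by simp
  then have sum: "summable d"
    using step by (intro summable_of_contraction_telescoping[of d b]) (auto simp: d_def)
  then have "Cauchy x" unfolding d_def by (rule Cauchy_of_summable_dist)
  then obtain x' where x': "x' \<in> B" "x \<longlonglongrightarrow> x'"
    using compact_imp_complete[OF B(1)] B(3) unfolding complete_def by blast
  have "decseq a" using a by (simp add: decseq_Suc_iff)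
  then obtain l where l: "a \<longlonglongrightarrow> l" "\<And>k. l \<le> a k"
    using decseq_convergent[of a 0] a by blast
  have "l = 0"
  proof (rule ccontr)
    assume "l \<noteq> 0"
    moreover have "l \<ge> 0" using l(1) a(1) by (intro LIMSEQ_le_const) auto
    ultimately have pos: "l > 0" by simp
    then have "isCont \<phi>' l"
      using deriv(1) by (simp add: continuous_on_eq_continuous_at)
    then have "(\<lambda>k. \<phi>' (a k) * (K * d k)) \<longlonglongrightarrow> \<phi>' l * (K * 0)"
      by (intro tendsto_intros isCont_tendsto_compose[OF _ l(1)] summable_LIMSEQ_zero sum)
    moreover have "1 \<le> \<phi>' (a k) * (K * d k)" for k
      using kl[of k] l(2)[of k] pos by (simp add: a_def d_def)
    ultimately have "1 \<le> \<phi>' l * (K * 0)" by (intro LIMSEQ_le_const) auto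
    then show False by simp
  qed
  have x'X: "x' \<in> X" using x' B by auto
  have "continuous_on X f"
    using f_tendsto by (simp add: continuous_on_def)
  then have "(\<lambda>k. f (x k)) \<longlonglongrightarrow> f x'"
    using x'(2) x'X desc(1) by (auto intro: continuous_on_tendsto_compose)
  then have "(\<lambda>k. f (x (Suc k))) \<longlonglongrightarrow> f x'" by (rule LIMSEQ_Suc)
  moreover have "(\<lambda>k. a k + Inf (f ` X)) \<longlonglongrightarrow> 0 + Inf (f ` X)"
    using l(1) \<open>l = 0\<close> by (intro tendsto_intros) auto
  moreover have "f (x (Suc k)) \<le> a k + Inf (f ` X)" for k using desc(4)[of k] by (simp add: a_def)
  ultimately have "f x' \<le> Inf (f ` X)" by (auto intro: LIMSEQ_le)
  then have "\<forall>y\<in>X. f x' \<le> f y" using Inf_f_le by force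
  then show ?thesis using x'(2) x'X by blast
qed

lemma mm_sequence_converges:
  assumes B: "B \<in> closed_balls X" and conc: "concave_on {0..} \<phi>"
    and KL: "KL_for_minimization B F \<phi>"
  shows "\<exists>\<epsilon>>0. \<forall>x. mm_sequence X D h x \<and> range x \<subseteq> B \<and> f (x 0) < Inf (f ` X) + \<epsilon> \<longrightarrow>
           (\<exists>x'\<in>X. x \<longlonglongrightarrow> x' \<and> (\<forall>y\<in>X. f x' \<le> f y))"
proof -
  have BX: "compact B" "B \<subseteq> X" "B \<noteq> {}"
    using B proper unfolding proper_space_def closed_balls_def by auto
  have F_ge: "Inf (F ` B) \<le> F y" if "y \<in> B" for y
    using that KL unfolding KL_for_minimization_def by (intro cInf_lower) auto
  have "Inf (f ` X) \<le> Inf (F ` B)"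
    using BX Inf_f_le_envelope by (intro cINF_greatest) auto
  then consider "Inf (f ` X) < Inf (F ` B)" | "Inf (F ` B) = Inf (f ` X)" by linarith
  then show ?thesis
  proof cases
    case 1
    have "\<not> f (x 0) < Inf (f ` X) + (Inf (F ` B) - Inf (f ` X))" if "range x \<subseteq> B" for x :: "nat \<Rightarrow> 'a"
    proof -
      have "x 0 \<in> B" using that by auto
      then show ?thesis using F_ge[of "x 0"] envelope_le_f[of "x 0"] BX(2) by auto
    qed
    then show ?thesis using 1 by (intro exI[of _ "Inf (F ` B) - Inf (f ` X)"]) auto
  next
    case 2
    from KL have desing: "desingularizer \<phi>" unfolding KL_for_minimization_def by blast
    then obtain \<phi>' where \<phi>': "continuous_on {0<..} \<phi>'"
      "\<And>t. t > 0 \<Longrightarrow> (\<phi> has_real_derivative \<phi>' t) (at t)" "\<And>t. t > 0 \<Longrightarrow> 0 < \<phi>' t"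
      unfolding desingularizer_def by blast
    obtain \<rho> where \<rho>: "\<rho> > 0"
      "\<And>y. y \<in> B \<Longrightarrow> Inf (f ` X) < F y \<Longrightarrow> F y - Inf (f ` X) < \<rho> \<Longrightarrow>
        1 \<le> slope_on B (\<lambda>y. \<phi> (F y - Inf (f ` X))) y"
      using KL unfolding KL_for_minimization_def 2 by auto
    obtain \<delta> c where c: "\<delta> > 0" "c \<ge> 0"
      "\<And>x. x \<in> B \<Longrightarrow> approximator_bounds h (X \<inter> ball x \<delta>) c"
      "\<And>x. x \<in> B \<Longrightarrow> approximator_bounds (\<lambda>x y. infdist y (D x)) (X \<inter> ball x \<delta>) c"
      using uniform_bounds[OF BX(1,2)] by blast
    \<comment> \<open>\<open>\<rho>\<close> keeps the iterates in the range of the KL inequality and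
      \<open>\<mu> * \<delta>^2 / 64\<close> in that of the slope bound; both persist because
      \<open>f\<close> does not increase along the sequence.\<close>
    define \<epsilon> where "\<epsilon> = min \<rho> (\<mu> * \<delta>\<^sup>2 / 64)"
    \<comment> \<open>The summand 1 keeps \<open>K\<close> positive when
      \<open>c = 0\<close>.\<close>
    define K where "K = 2 * (c + c\<^sup>2) + 1"
    have K: "K > 0" "2 * (c + c\<^sup>2) \<le> K" using c(2) by (auto simp: K_def add_nonneg_pos)
    have "\<exists>x'\<in>X. x \<longlonglongrightarrow> x' \<and> (\<forall>y\<in>X. f x' \<le> f y)"
      if mm: "mm_sequence X D h x" and xB: "range x \<subseteq> B" and x0: "f (x 0) < Inf (f ` X) + \<epsilon>" for x
    proof (rule mm_sequence_tendsto_minimizer[OF mm BX(1,2) xB desing conc K(1) \<phi>'(1,2)])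
      fix k assume pos: "F (x k) > Inf (f ` X)"
      have xk: "x k \<in> B" "x k \<in> X" using xB BX by auto
      have fx: "f (x k) < Inf (f ` X) + \<epsilon>" using x0 mm_sequence_f_le_initial[OF mm, of k] by linarith
      have "1 \<le> \<phi>' (F (x k) - Inf (f ` X)) * (2 * (c + c\<^sup>2) * dist (x k) (x (Suc k)))"
      proof (rule slope_chain_rule_bound[where G = F, OF xk(1) pos])
        show "\<forall>\<^sub>F y in at (x k) within B. F (x k) -
            (2 * (c + c\<^sup>2) * dist (x k) (x (Suc k)) + e) * dist (x k) y \<le> F y" if "e > 0" for e
        \<comment> \<open>The slope estimate holds for nearby points of \<open>X\<close>, hence for
          those of the subset \<open>B\<close>, on which the KL property is stated.\<close>
        proof (rule filter_leD[OF at_le[OF BX(2)] envelope_slope_bound])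
          show "f (x k) < Inf (f ` X) + \<mu> * \<delta>\<^sup>2 / 64" using fx by (simp add: \<epsilon>_def)
        qed (use c xk that mm_sequence_descent(2)[OF mm] in auto)
        show "1 \<le> slope_on B (\<lambda>y. \<phi> (F y - Inf (f ` X))) (x k)"
          using \<rho>(2)[OF xk(1) pos] envelope_le_f[OF xk(2)] fx by (simp add: \<epsilon>_def)
      qed (use F_ge 2 \<phi>'(2,3) pos desingularizer_mono_on[OF desing] c(2) in auto)
      also have "\<dots> \<le> \<phi>' (F (x k) - Inf (f ` X)) * (K * dist (x k) (x (Suc k)))"
        using K \<phi>'(3)[of "F (x k) - Inf (f ` X)"] pos by (intro mult_left_mono mult_right_mono) auto
      finally show "1 \<le> \<phi>' (F (x k) - Inf (f ` X)) * (K * dist (x k) (x (Suc k)))" .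
    qed
    moreover have "\<epsilon> > 0" using \<rho>(1) mu_pos c(1) by (simp add: \<epsilon>_def)
    ultimately show ?thesis by blast
  qed
qed

end

theorem theorem7p22:
  fixes X :: "'a::metric_space set"
    and f :: "'a \<Rightarrow> real"
    and D :: "'a \<Rightarrow> 'a set"
    and \<mu> :: real
    and h :: "'a \<Rightarrow> 'a \<Rightarrow> real"
  assumes "majorization_minimization X f D \<mu> h"
    and "\<forall>B\<in>closed_balls X. \<exists>\<phi>. concave_on {0..} \<phi> \<and> KL_for_minimization B (mm_envelope D h) \<phi>"
  shows "\<forall>B\<in>closed_balls X. \<exists>\<epsilon>>0. \<forall>x.
           mm_sequence X D h x \<and> range x \<subseteq> B \<and> f (x 0) < Inf (f ` X) + \<epsilon> \<longrightarrow>
             (\<exists>x'\<in>X. x \<longlonglongrightarrow> x' \<and> (\<forall>y\<in>X. f x' \<le> f y))"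
proof
  fix B assume B: "B \<in> closed_balls X"
  then obtain \<phi> where "concave_on {0..} \<phi>" "KL_for_minimization B (mm_envelope D h) \<phi>"
    using assms(2) by blast
  then show "\<exists>\<epsilon>>0. \<forall>x. mm_sequence X D h x \<and> range x \<subseteq> B \<and> f (x 0) < Inf (f ` X) + \<epsilon> \<longrightarrow>
               (\<exists>x'\<in>X. x \<longlonglongrightarrow> x' \<and> (\<forall>y\<in>X. f x' \<le> f y))"
    by (rule majorization_minimization.mm_sequence_converges[OF assms(1) B])
qed

end
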